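(* Let $(\mathcal{A},\mu,\alpha)$ be a multiplicative Hom-associative algebra over a field $k$, with algebraic dual $\mathcal{A}^\ast$. Then the subspace $$\mathcal{A}^\circ=\{f\in\mathcal{A}^\ast\mid f(x\alpha(y))=f(\alpha(xy))=f(\alpha(x)y)\ \text{for all } x,y\in\mathcal{A}\}\subseteq\mathcal{A}^\ast,$$ equipped with the left action $(a\cdot f)(b)=f(b\alpha(a))$, the right action $(f\cdot a)(b)=f(\alpha(a)b)$, and the map $\beta=\mathrm{Id}$, is an $\mathcal{A}$-bimodule.
   Context: A Hom-associative algebra $(\mathcal{A},\mu,\alpha)$ over a field $k$ is a $k$-vector space $\mathcal{A}$ with linear maps $\mu:\mathcal{A}\otimes\mathcal{A}\to\mathcal{A}$, written $ab$, and $\alpha:\mathcal{A}\to\mathcal{A}$ such that $\alpha(a)(bc)=(ab)\alpha(c)$. It is multiplicative if $\alpha(ab)=\alpha(a)\alpha(b)$. No unit is assumed. An $\mathcal{A}$-bimodule is a vector space $V$ with bilinear actions $a\cdot v\in V$, $v\cdot a\in V$ and a linear map $\beta:V\to V$ such that for all $a,b\in\mathcal{A}$, $v\in V$: $(ab)\cdot\beta(v)=\alpha(a)\cdot(b\cdot v)$ (left module), $\beta(v)\cdot(ab)=(v\cdot a)\cdot\alpha(b)$ (right module), and $\alpha(a)\cdot(v\cdot b)=(a\cdot v)\cdot\alpha(b)$. *)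

theory Defs
  imports Complex_Main "HOL-Library.Function_Algebras"
begin

text \<open>The algebra lives on a whole type, with scalar multiplication \<open>scale\<close> and the
  (non-unital) product \<open>mul\<close> as parameters; a linear map out of the tensor square is
  rendered as a bilinear map.\<close>

locale hom_assoc_algebra = vector_space scale
  for scale :: "'k::field \<Rightarrow> 'a::ab_group_add \<Rightarrow> 'a" +
  fixes mul :: "'a \<Rightarrow> 'a \<Rightarrow> 'a"
    and \<alpha> :: "'a \<Rightarrow> 'a"
  assumes linear_mul_left: "\<And>b. Vector_Spaces.linear scale scale (\<lambda>a. mul a b)"
    and linear_mul_right: "\<And>a. Vector_Spaces.linear scale scale (\<lambda>b. mul a b)"
    and linear_twist: "Vector_Spaces.linear scale scale \<alpha>"
    and hom_assoc: "\<And>a b c. mul (\<alpha> a) (mul b c) = mul (mul a b) (\<alpha> c)"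

locale multiplicative_hom_assoc_algebra = hom_assoc_algebra +
  assumes multiplicative: "\<And>a b. \<alpha> (mul a b) = mul (\<alpha> a) (\<alpha> b)"

text \<open>A linear map between two subspaces of ambient vector spaces; the values of \<open>f\<close>
  outside \<open>S\<close> are irrelevant.\<close>

definition linear_between ::
  "('k::field \<Rightarrow> 'b::ab_group_add \<Rightarrow> 'b) \<Rightarrow> 'b set \<Rightarrow>
   ('k \<Rightarrow> 'c::ab_group_add \<Rightarrow> 'c) \<Rightarrow> 'c set \<Rightarrow> ('b \<Rightarrow> 'c) \<Rightarrow> bool" where
  "linear_between s S t T f \<longleftrightarrow>
     (\<forall>x\<in>S. f x \<in> T) \<and>
     (\<forall>x\<in>S. \<forall>y\<in>S. f (x + y) = f x + f y) \<and>
     (\<forall>c. \<forall>x\<in>S. f (s c x) = t c (f x))"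

text \<open>The underlying vector space of a bimodule is a subspace \<open>V\<close> of an ambient vector space,
  so that bimodules whose elements are linear forms can be described without
  introducing a new type. The actions are \<open>lact a v\<close> for \<open>a \<cdot> v\<close> and
  \<open>ract v a\<close> for \<open>v \<cdot> a\<close>.\<close>

locale hom_bimodule =
  A: hom_assoc_algebra scale mul \<alpha> + V: vector_space scaleV
  for scale :: "'k::field \<Rightarrow> 'a::ab_group_add \<Rightarrow> 'a"
    and mul :: "'a \<Rightarrow> 'a \<Rightarrow> 'a"
    and \<alpha> :: "'a \<Rightarrow> 'a"
    and scaleV :: "'k \<Rightarrow> 'v::ab_group_add \<Rightarrow> 'v" +
  fixes V :: "'v set"
    and lact :: "'a \<Rightarrow> 'v \<Rightarrow> 'v"
    and ract :: "'v \<Rightarrow> 'a \<Rightarrow> 'v"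
    and \<beta> :: "'v \<Rightarrow> 'v"
  assumes subspace_carrier: "V.subspace V"
    and lact_linear_vector: "\<And>a. linear_between scaleV V scaleV V (\<lambda>v. lact a v)"
    and lact_linear_algebra: "\<And>v. v \<in> V \<Longrightarrow> linear_between scale UNIV scaleV V (\<lambda>a. lact a v)"
    and ract_linear_vector: "\<And>a. linear_between scaleV V scaleV V (\<lambda>v. ract v a)"
    and ract_linear_algebra: "\<And>v. v \<in> V \<Longrightarrow> linear_between scale UNIV scaleV V (\<lambda>a. ract v a)"
    and beta_linear: "linear_between scaleV V scaleV V \<beta>"
    and left_module: "\<And>a b v. v \<in> V \<Longrightarrow> lact (mul a b) (\<beta> v) = lact (\<alpha> a) (lact b v)"
    and right_module: "\<And>a b v. v \<in> V \<Longrightarrow> ract (\<beta> v) (mul a b) = ract (ract v a) (\<alpha> b)"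
    and bimodule: "\<And>a b v. v \<in> V \<Longrightarrow> lact (\<alpha> a) (ract v b) = ract (lact a v) (\<alpha> b)"

text \<open>Linear forms are functions into the field; their addition is the pointwise one of
  \<open>Function_Algebras\<close>.\<close>

definition scale_form :: "'k::field \<Rightarrow> ('a \<Rightarrow> 'k) \<Rightarrow> 'a \<Rightarrow> 'k" where
  "scale_form c f = (\<lambda>x. c * f x)"

definition dual_space :: "('k::field \<Rightarrow> 'a::ab_group_add \<Rightarrow> 'a) \<Rightarrow> ('a \<Rightarrow> 'k) set" where
  "dual_space scale = {f. Vector_Spaces.linear scale (*) f}"

definition circ_dual ::
  "('k::field \<Rightarrow> 'a::ab_group_add \<Rightarrow> 'a) \<Rightarrow> ('a \<Rightarrow> 'a \<Rightarrow> 'a) \<Rightarrow> ('a \<Rightarrow> 'a) \<Rightarrow> ('a \<Rightarrow> 'k) set" where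
  "circ_dual scale mul \<alpha> =
     {f \<in> dual_space scale.
        \<forall>x y. f (mul x (\<alpha> y)) = f (\<alpha> (mul x y)) \<and> f (\<alpha> (mul x y)) = f (mul (\<alpha> x) y)}"

definition dual_lact ::
  "('a \<Rightarrow> 'a \<Rightarrow> 'a) \<Rightarrow> ('a \<Rightarrow> 'a) \<Rightarrow> 'a \<Rightarrow> ('a \<Rightarrow> 'k) \<Rightarrow> 'a \<Rightarrow> 'k" where
  "dual_lact mul \<alpha> a f = (\<lambda>b. f (mul b (\<alpha> a)))"

definition dual_ract ::
  "('a \<Rightarrow> 'a \<Rightarrow> 'a) \<Rightarrow> ('a \<Rightarrow> 'a) \<Rightarrow> ('a \<Rightarrow> 'k) \<Rightarrow> 'a \<Rightarrow> 'a \<Rightarrow> 'k" where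
  "dual_ract mul \<alpha> f a = (\<lambda>b. f (mul (\<alpha> a) b))"

end

theory Submission imports Defs begin

text \<open>For \<open>f\<close> in the restricted dual, multiplicativity turns the defining identities into the
  absorption rule \<open>f (\<alpha> x \<cdot> \<alpha> y) = f (\<alpha> x \<cdot> y)\<close>. Together with Hom-associativity this shows
  that \<open>f\<close> takes on every triple product with at least one outer twist the value
  \<open>f (\<alpha> x (y z))\<close>, however many further twists are applied to its factors. Closure under the
  actions and all module identities compare two such values.\<close>

lemma vector_space_scale_form: "vector_space scale_form"
  by unfold_locales (auto simp: scale_form_def fun_eq_iff algebra_simps)

lemma dual_lact_linear_vector:
  "dual_lact mul \<alpha> a (f + g) = dual_lact mul \<alpha> a f + dual_lact mul \<alpha> a g"
  "dual_lact mul \<alpha> a (scale_form c f) = scale_form c (dual_lact mul \<alpha> a f)"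
  by (simp_all add: dual_lact_def scale_form_def fun_eq_iff)

lemma dual_ract_linear_vector:
  "dual_ract mul \<alpha> (f + g) a = dual_ract mul \<alpha> f a + dual_ract mul \<alpha> g a"
  "dual_ract mul \<alpha> (scale_form c f) a = scale_form c (dual_ract mul \<alpha> f a)"
  by (simp_all add: dual_ract_def scale_form_def fun_eq_iff)

context multiplicative_hom_assoc_algebra
begin

lemma dual_space_iff:
  "f \<in> dual_space scale \<longleftrightarrow>
     (\<forall>x y. f (x + y) = f x + f y) \<and> (\<forall>c x. f (scale c x) = c * f x)"
proof -
  \<comment> \<open>Here \<open>'a\<close> is the scalar field, viewed as a vector space over
    itself: the target of a linear form.\<close>
  have "vector_space ((*) :: 'a \<Rightarrow> 'a \<Rightarrow> 'a)"
    by unfold_locales (auto simp: algebra_simps)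
  then show ?thesis
    using vector_space_axioms by (simp add: dual_space_def Vector_Spaces.linear_iff)
qed

lemma mul_linear_simps:
  "mul (a + b) c = mul a c + mul b c"
  "mul c (a + b) = mul c a + mul c b"
  "mul (scale r a) c = scale r (mul a c)"
  "mul c (scale r a) = scale r (mul c a)"
  "\<alpha> (a + b) = \<alpha> a + \<alpha> b"
  "\<alpha> (scale r a) = scale r (\<alpha> a)"
  using linear_mul_left linear_mul_right linear_twist
  by (simp_all add: Vector_Spaces.linear_iff)

context
  fixes f
  assumes f: "f \<in> circ_dual scale mul \<alpha>"
begin

lemma circ_dual_linear:
  "f (x + y) = f x + f y" "f (scale c x) = c * f x"
  using f by (simp_all add: circ_dual_def dual_space_iff)

lemma circ_dual_twist_right: "f (mul x (\<alpha> y)) = f (mul (\<alpha> x) y)"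
  using f by (simp add: circ_dual_def)

lemma circ_dual_twist_both: "f (mul (\<alpha> x) (\<alpha> y)) = f (mul (\<alpha> x) y)"
  using f by (simp add: circ_dual_def flip: multiplicative)

text \<open>One of the two twists crosses to y, where \<open>circ_dual_twist_both\<close> absorbs
  it.\<close>

lemma circ_dual_twist_twice: "f (mul (\<alpha> (\<alpha> x)) y) = f (mul (\<alpha> x) y)"
  by (metis circ_dual_twist_right circ_dual_twist_both)

lemma circ_dual_reassoc: "f (mul (mul x y) (\<alpha> z)) = f (mul (\<alpha> x) (mul y z))"
  by (simp add: hom_assoc)

lemma circ_dual_absorb_middle: "f (mul (\<alpha> x) (mul (\<alpha> y) z)) = f (mul (\<alpha> x) (mul y z))"
proof -
  \<comment> \<open>Both sides reduce to f(\<alpha>(xy) z). The extra twist on z lets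
    Hom-associativity apply again once \<alpha>(xy) is split.\<close>
  have "f (mul (\<alpha> x) (mul y z)) = f (mul (\<alpha> (mul x y)) (\<alpha> z))"
    by (simp only: hom_assoc circ_dual_twist_right circ_dual_twist_twice)
  also have "\<dots> = f (mul (\<alpha> (\<alpha> x)) (mul (\<alpha> y) z))"
    by (simp only: multiplicative hom_assoc)
  finally show ?thesis
    by (simp only: circ_dual_twist_twice)
qed

text \<open>After regrouping around xy, all twists on z cross to xy and collapse to one.\<close>

lemma circ_dual_absorb_right: "f (mul (\<alpha> x) (mul y (\<alpha> z))) = f (mul (\<alpha> x) (mul y z))"
  by (simp only: hom_assoc circ_dual_twist_right circ_dual_twist_twice)

text \<open>Rewrite rules towards the normal form f(\<alpha>(x)(yz)).
  \<open>circ_dual_twist_right\<close> stays out, since it competes with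
  \<open>circ_dual_reassoc\<close> on (xy)\<alpha>(z).\<close>

lemmas circ_dual_absorb =
  circ_dual_reassoc circ_dual_twist_both circ_dual_twist_twice
  circ_dual_absorb_middle circ_dual_absorb_right

text \<open>The three expressions to be compared all become f(\<alpha>(x)(ya)); for the right action
  they become f(\<alpha>(a)(xy)).\<close>

lemma dual_lact_in_circ_dual: "dual_lact mul \<alpha> a f \<in> circ_dual scale mul \<alpha>"
  by (simp add: circ_dual_def dual_lact_def dual_space_iff mul_linear_simps circ_dual_linear
      multiplicative circ_dual_absorb)

lemma dual_ract_in_circ_dual: "dual_ract mul \<alpha> f a \<in> circ_dual scale mul \<alpha>"
  by (simp add: circ_dual_def dual_ract_def dual_space_iff mul_linear_simps circ_dual_linear
      multiplicative circ_dual_absorb)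

text \<open>At c both sides equal f(\<alpha>(c)(ab)), once the twist on ab has crossed to c.\<close>

lemma dual_lact_mul:
  "dual_lact mul \<alpha> (mul a b) f = dual_lact mul \<alpha> (\<alpha> a) (dual_lact mul \<alpha> b f)"
  by (simp add: dual_lact_def fun_eq_iff circ_dual_twist_right[of _ "mul _ _"] circ_dual_absorb)

text \<open>The mirror case: the twist on ab crosses to the argument c on its right, and the common
  value is f(\<alpha>(a)(bc)).\<close>

lemma dual_ract_mul:
  "dual_ract mul \<alpha> f (mul a b) = dual_ract mul \<alpha> (dual_ract mul \<alpha> f a) (\<alpha> b)"
  by (simp add: dual_ract_def fun_eq_iff circ_dual_absorb flip: circ_dual_twist_right[of "mul _ _"])

text \<open>At c both sides equal f(\<alpha>(b)(ca)).\<close>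

lemma dual_lact_dual_ract:
  "dual_lact mul \<alpha> (\<alpha> a) (dual_ract mul \<alpha> f b) = dual_ract mul \<alpha> (dual_lact mul \<alpha> a f) (\<alpha> b)"
  by (simp add: dual_lact_def dual_ract_def fun_eq_iff circ_dual_absorb)

lemma dual_lact_linear_algebra:
  "dual_lact mul \<alpha> (a + b) f = dual_lact mul \<alpha> a f + dual_lact mul \<alpha> b f"
  "dual_lact mul \<alpha> (scale c a) f = scale_form c (dual_lact mul \<alpha> a f)"
  by (simp_all add: dual_lact_def scale_form_def fun_eq_iff mul_linear_simps circ_dual_linear)

lemma dual_ract_linear_algebra:
  "dual_ract mul \<alpha> f (a + b) = dual_ract mul \<alpha> f a + dual_ract mul \<alpha> f b"
  "dual_ract mul \<alpha> f (scale c a) = scale_form c (dual_ract mul \<alpha> f a)"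
  by (simp_all add: dual_ract_def scale_form_def fun_eq_iff mul_linear_simps circ_dual_linear)

end

lemma subspace_circ_dual: "module.subspace scale_form (circ_dual scale mul \<alpha>)"
proof -
  interpret D: vector_space scale_form
    by (rule vector_space_scale_form)
  show ?thesis
    by (rule D.subspaceI)
      (auto simp: circ_dual_def dual_space_iff scale_form_def algebra_simps)
qed

end

theorem proposition2p10:
  fixes scale :: "'k::field \<Rightarrow> 'a::ab_group_add \<Rightarrow> 'a"
    and mul :: "'a \<Rightarrow> 'a \<Rightarrow> 'a"
    and \<alpha> :: "'a \<Rightarrow> 'a"
  assumes "multiplicative_hom_assoc_algebra scale mul \<alpha>"
  shows "hom_bimodule scale mul \<alpha> scale_form (circ_dual scale mul \<alpha>)
           (dual_lact mul \<alpha>) (dual_ract mul \<alpha>) id"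
proof -
  interpret multiplicative_hom_assoc_algebra scale mul \<alpha>
    by (rule assms)
  show ?thesis
  proof (intro hom_bimodule.intro hom_bimodule_axioms.intro)
    show "hom_assoc_algebra scale mul \<alpha>"
      by (rule hom_assoc_algebra_axioms)
  \<comment> \<open>As \<beta> is the identity, the left and right module laws are exactly
    \<open>dual_lact_mul\<close> and \<open>dual_ract_mul\<close>.\<close>
  qed (auto simp: vector_space_scale_form subspace_circ_dual linear_between_def
      dual_lact_in_circ_dual dual_ract_in_circ_dual dual_lact_mul dual_ract_mul
      dual_lact_dual_ract dual_lact_linear_vector dual_ract_linear_vector
      dual_lact_linear_algebra dual_ract_linear_algebra)
qed

end
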